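(* There exist positive absolute constants $K$ and $c$ such that the following holds. Let $n\ge 1$, let $B$ be a convex body in $\mathbb{R}^n$ contained in $[0,1]^n$, and let $D_n$ be the unit Euclidean ball in $\mathbb{R}^n$. Then for every $0<t<1$, $$N(B,t\sqrt{n}\,D_n)\le \Big(\frac{2}{t}\Big)^{Kd},$$ where $d$ is the maximal cardinality of a subset $\sigma\subset\{1,\dots,n\}$ such that $$P_\sigma(B)\supseteq h+[0,ct]^\sigma\quad\text{for some vector } h\in\mathbb{R}^\sigma .$$
   Context: For sets $B,D\subset\mathbb{R}^n$, $N(B,D)$ is the minimal number of translates of $D$ needed to cover $B$. For $\sigma\subset\{1,\dots,n\}$, $P_\sigma$ is the orthogonal projection in $\mathbb{R}^n$ onto the coordinate subspace $\mathbb{R}^\sigma$. The empty set $\sigma=\emptyset$ always satisfies the inclusion condition, so $d\ge 0$ is well defined. *)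

theory Defs
  imports "HOL-Analysis.Analysis" "HOL-Library.Function_Algebras"
begin

(* The dimension is quantified inside the scope of the absolute constants, so it cannot be a type.
   All spaces therefore live in the one vector space of real sequences (pointwise operations),
   with the coordinates of R^n numbered 0, ..., n - 1 and all further coordinates zero,
   as in the library's Euclidean_space n. *)

instantiation "fun" :: (type, real_vector) real_vector
begin

definition scaleR_fun_def: "scaleR r f = (\<lambda>i. r *\<^sub>R f i)"

instance
  by standard (simp_all add: scaleR_fun_def plus_fun_def algebra_simps)

end

(* The coordinate subspace R^s; R^n is the case s = {..<n}. *)
definition coord_subspace :: "nat set \<Rightarrow> (nat \<Rightarrow> real) set" where
  "coord_subspace s = {x. \<forall>i. i \<notin> s \<longrightarrow> x i = 0}"

lemma topspace_Euclidean_space_eq: "topspace (Euclidean_space n) = coord_subspace {..<n}"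
  by (auto simp: topspace_Euclidean_space coord_subspace_def)

definition coord_proj :: "nat set \<Rightarrow> (nat \<Rightarrow> real) \<Rightarrow> (nat \<Rightarrow> real)" where
  "coord_proj s x = (\<lambda>i. if i \<in> s then x i else 0)"

definition cube :: "nat set \<Rightarrow> real \<Rightarrow> (nat \<Rightarrow> real) set" where
  "cube s a = {x \<in> coord_subspace s. \<forall>i\<in>s. 0 \<le> x i \<and> x i \<le> a}"

(* The norm and dist of the type nat => real play no role; the Euclidean norm is L2_set. *)
definition unit_ball :: "nat \<Rightarrow> (nat \<Rightarrow> real) set" where
  "unit_ball n = {x \<in> coord_subspace {..<n}. L2_set x {..<n} \<le> 1}"

definition convex_body :: "nat \<Rightarrow> (nat \<Rightarrow> real) set \<Rightarrow> bool" where
  "convex_body n B \<longleftrightarrow>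
     convex B \<and> compactin (Euclidean_space n) B \<and> (Euclidean_space n) interior_of B \<noteq> {}"

(* The value is infinite when no finite cover exists. *)
definition covering_number ::
  "nat \<Rightarrow> (nat \<Rightarrow> real) set \<Rightarrow> (nat \<Rightarrow> real) set \<Rightarrow> enat" where
  "covering_number n B D =
     (INF A \<in> {A. finite A \<and> A \<subseteq> coord_subspace {..<n} \<and> B \<subseteq> (\<Union>a\<in>A. (+) a ` D)}. enat (card A))"

(* The set under Max is finite and, for nonempty B, contains 0 (take s = {}). *)
definition max_cube_dim :: "nat \<Rightarrow> (nat \<Rightarrow> real) set \<Rightarrow> real \<Rightarrow> nat" where
  "max_cube_dim n B a =
     Max {card s | s. s \<subseteq> {..<n} \<and>
       (\<exists>h \<in> coord_subspace s. (+) h ` cube s a \<subseteq> coord_proj s ` B)}"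

end

theory Submission
  imports Defs
begin

text \<open>
  A maximal subset of \<open>B\<close> whose points are pairwise at distance at least \<open>t \<surd>n\<close> covers \<open>B\<close> by the
  balls around its points, so it suffices to bound the size \<open>N\<close> of any such separated set \<open>A\<close> by
  \<open>(2 / t)\<close> to the power \<open>40 d\<close>. This is the entropy bound of Mendelson and Vershynin through the
  combinatorial dimension.

  Round the coordinates of \<open>A\<close> to multiples of \<open>t / 16\<close>. Some coordinate \<open>i\<close> then has, over pairs
  from \<open>A\<close>, a mean square difference larger than an absolute constant. A distribution with such a
  spread cannot have geometrically decaying tails on both sides of its median, so there is a level
  \<open>a\<close> for which the low part (coordinate at most \<open>a\<close>) and the high part (coordinate at least
  \<open>a + 2\<close>) satisfy \<open>\<surd>|low| + \<surd>|high| \<ge> \<surd>|A|\<close> (\<open>spread_coordinate_split\<close>). Call a set of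
  coordinates with levels \<open>h\<close> shattered by \<open>A\<close> if every pattern of being below \<open>h\<close> or above
  \<open>h + 2\<close> occurs in \<open>A\<close>. A pair shattered by both parts can be extended by \<open>(i, a)\<close>, so the number
  of shattered pairs is at least the sum of the numbers for the two parts
  (\<open>card_shattered_cubes_superadditive\<close>). Induction gives at least \<open>\<surd>N\<close> shattered pairs
  (\<open>sqrt_card_le_card_shattered_cubes\<close>).

  As \<open>B\<close> is convex, a shattered pair yields a cube of side \<open>t / 16\<close> in the projection of \<open>B\<close> to these
  coordinates: the point with prescribed coordinates is found by moving along segments, one
  coordinate at a time (\<open>convex_meets_prescribed_coordinates\<close>). Hence a shattered pair involves at
  most \<open>d\<close> coordinates, and there are few such pairs, provided that the number of coordinates is small.
  To remove the dependence on \<open>n\<close>, a random choice of \<open>m \<approx> ln N / t\<^sup>2\<close> coordinates, with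
  repetitions, keeps \<open>A\<close> separated at half the scale (\<open>coordinate_sampling\<close>).

  For the count, a pair with \<open>k \<le> d\<close> coordinates has weight \<open>\<theta>\<^sup>k \<ge> \<theta>\<^sup>d\<close>, and the total weight over all
  pairs with \<open>P\<close> levels is \<open>(1 + \<theta> P)\<^sup>m \<le> exp (\<theta> P m)\<close>. As \<open>P m\<close> is at most a constant times
  \<open>ln N / t\<^sup>3\<close>, taking \<open>\<theta>\<close> to be a power of \<open>t / 2\<close> makes the exponent at most \<open>(ln N) / 4\<close>. So
  \<open>\<theta>\<^sup>d \<surd>N\<close> is at most the fourth root of \<open>N\<close>, which is the claim (\<open>card_separated_le\<close>).
\<close>

section \<open>Splitting at a spread-out coordinate\<close>

text \<open>The middle part of the split, of size \<open>q - r\<close>, is lost; the concavity of the square root pays for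
  it because the high part has at least half of the \<open>q\<close> points and the low part is no smaller than \<open>q\<close>.\<close>

lemma sqrt_le_add_sqrt_split:
  fixes N q r :: real
  assumes "0 \<le> q" "2 * q \<le> N" "q \<le> 2 * r"
  shows "sqrt N \<le> sqrt (N - q) + sqrt r"
proof -
  have "(q/2)^2 \<le> q * (q/2)" using assms by (simp add: power2_eq_square)
  also have "\<dots> \<le> (N - q) * r" using assms by (intro mult_mono) auto
  finally have "q/2 \<le> sqrt ((N - q) * r)" by (rule real_le_rsqrt)
  hence "q \<le> 2 * (sqrt (N - q) * sqrt r)" by (simp add: real_sqrt_mult)
  moreover have "(sqrt (N - q))^2 = N - q" "(sqrt r)^2 = r" using assms by auto
  ultimately have "N \<le> (sqrt (N - q) + sqrt r)^2"
    using assms by (simp add: power2_sum)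
  thus ?thesis using assms by (intro real_le_lsqrt) auto
qed

lemma sum_odd_div_power2:
  "(\<Sum>k<K. (2 * real k + 1) / 2 ^ (k + 1)) = 3 - (2 * real K + 3) / 2 ^ K"
  by (induction K) (auto simp: field_simps)

lemma nat_square_eq_sum_odd: "(\<Sum>k<n. 2 * real k + 1) = (real n)^2"
  by (induction n) (auto simp: power2_eq_square algebra_simps)

text \<open>If each unit step above \<open>M\<close> halves the tail, the tails are dominated by a geometric series, and so
  the second moment is bounded by an absolute constant times the number of points.\<close>

lemma geometric_tail_second_moment:
  fixes g :: "'a \<Rightarrow> int" and M :: int
  assumes fin: "finite A"
    and half: "2 * card {x \<in> A. g x > M} \<le> card A"
    and dec: "\<And>k::nat. 2 * card {x \<in> A. g x > M + int (Suc k)} \<le> card {x \<in> A. g x > M + int k}"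
  shows "(\<Sum>x\<in>A. (real (nat (g x - M)))^2) \<le> 3 * real (card A)"
proof -
  define F where "F k = card {x \<in> A. g x > M + int k}" for k
  have F: "2 ^ (k + 1) * F k \<le> card A" for k
  proof (induction k)
    case 0 thus ?case using half by (simp add: F_def)
  next
    case (Suc k)
    have "2 * F (Suc k) \<le> F k" using dec by (simp add: F_def)
    hence "2 ^ (k + 1) * (2 * F (Suc k)) \<le> 2 ^ (k + 1) * F k" by (rule mult_left_mono) simp
    moreover have "2 ^ (Suc k + 1) * F (Suc k) = 2 ^ (k + 1) * (2 * F (Suc k))" by simp
    ultimately show ?case using Suc by linarith
  qed
  have Fr: "real (F k) \<le> real (card A) / 2 ^ (k + 1)" for k
  proof -
    have "real (2 ^ (k + 1) * F k) \<le> real (card A)" using F by (rule of_nat_mono)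
    thus ?thesis by (simp add: field_simps)
  qed
  define K where "K = Max (insert 0 ((\<lambda>x. nat (g x - M)) ` A))"
  have K: "nat (g x - M) \<le> K" if "x \<in> A" for x
    unfolding K_def using fin that by (intro Max_ge) auto
  have "(\<Sum>x\<in>A. (real (nat (g x - M)))^2)
      = (\<Sum>x\<in>A. \<Sum>k<K. if g x > M + int k then 2 * real k + 1 else 0)"
  proof (rule sum.cong[OF refl])
    fix x assume x: "x \<in> A"
    have "(real (nat (g x - M)))^2 = (\<Sum>k<nat (g x - M). 2 * real k + 1)"
      by (rule nat_square_eq_sum_odd[symmetric])
    also have "{..<nat (g x - M)} = {k \<in> {..<K}. g x > M + int k}" using K[OF x] by auto
    also have "(\<Sum>k\<in>\<dots>. 2 * real k + 1)
        = (\<Sum>k<K. if g x > M + int k then 2 * real k + 1 else 0)"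
      by (rule sum.inter_filter) simp
    finally show "(real (nat (g x - M)))^2
        = (\<Sum>k<K. if g x > M + int k then 2 * real k + 1 else 0)" .
  qed
  also have "\<dots> = (\<Sum>k<K. \<Sum>x\<in>A. if g x > M + int k then 2 * real k + 1 else 0)"
    by (rule sum.swap)
  also have "\<dots> = (\<Sum>k<K. real (F k) * (2 * real k + 1))"
    using fin by (intro sum.cong refl) (simp add: F_def sum.inter_filter[symmetric])
  also have "\<dots> \<le> (\<Sum>k<K. real (card A) / 2 ^ (k + 1) * (2 * real k + 1))"
    using Fr by (intro sum_mono mult_right_mono) auto
  also have "\<dots> = real (card A) * (\<Sum>k<K. (2 * real k + 1) / 2 ^ (k + 1))"
    by (simp add: sum_distrib_left)
  also have "\<dots> \<le> real (card A) * 3"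
    unfolding sum_odd_div_power2 by (intro mult_left_mono) auto
  finally show ?thesis by simp
qed

lemma int_median_exists:
  fixes g :: "'a \<Rightarrow> int"
  assumes fin: "finite A"
  obtains M where "2 * card {x \<in> A. g x > M} \<le> card A" "2 * card {x \<in> A. g x < M} \<le> card A"
proof (cases "A = {}")
  case True thus ?thesis using that[of 0] by simp
next
  case False
  define lo where "lo = Min (g ` A)"
  have lo: "lo \<le> g x" if "x \<in> A" for x using fin that by (simp add: lo_def)
  define P where "P k \<longleftrightarrow> 2 * card {x \<in> A. g x > lo + int k} \<le> card A" for k
  have "P (nat (Max (g ` A) - lo))"
  proof -
    have "{x \<in> A. g x > lo + int (nat (Max (g ` A) - lo))} = {}"
    proof -
      have "g x \<le> lo + int (nat (Max (g ` A) - lo))" if "x \<in> A" for x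
      proof -
        have "g x \<le> Max (g ` A)" using fin that by simp
        also have "\<dots> \<le> lo + int (nat (Max (g ` A) - lo))" by linarith
        finally show ?thesis .
      qed
      thus ?thesis by (auto simp: not_less)
    qed
    thus ?thesis unfolding P_def by (metis card.empty mult_0_right zero_le)
  qed
  hence PL: "P (Least P)" by (rule LeastI)
  have "2 * card {x \<in> A. g x < lo + int (Least P)} \<le> card A"
  proof (cases "Least P")
    case 0
    have "{x \<in> A. g x < lo} = {}" using lo by fastforce
    hence "card {x \<in> A. g x < lo + int (Least P)} = 0" unfolding 0 by (simp only: of_nat_0 add_0_right card.empty)
    thus ?thesis by simp
  next
    case (Suc k)
    hence "\<not> P k" using not_less_Least[of k P] by simp
    hence *: "2 * card {x \<in> A. g x > lo + int k} > card A" by (simp add: P_def)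
    have "{x \<in> A. g x < lo + int (Suc k)} = A - {x \<in> A. g x > lo + int k}" by auto
    hence "card {x \<in> A. g x < lo + int (Suc k)} = card A - card {x \<in> A. g x > lo + int k}"
      using fin by (simp add: card_Diff_subset)
    thus ?thesis using * Suc by simp
  qed
  thus ?thesis using that PL by (simp add: P_def)
qed

text \<open>A step at which the tail fails to halve is a good place to cut: the \<open>q\<close> points above
  \<open>M + k\<close> are at most half of \<open>A\<close>, and more than \<open>q / 2\<close> of them lie at least two units above the
  low part.\<close>

lemma slow_tail_split:
  fixes g :: "'a \<Rightarrow> int"
  assumes fin: "finite A" and half: "2 * card {x \<in> A. g x > M} \<le> card A"
    and slow: "\<not> 2 * card {x \<in> A. g x > M + int (Suc k)} \<le> card {x \<in> A. g x > M + int k}"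
  shows "{x \<in> A. g x \<le> M + int k} \<noteq> {}" "{x \<in> A. M + int k + 2 \<le> g x} \<noteq> {}"
    "sqrt (card A) \<le> sqrt (card {x \<in> A. g x \<le> M + int k}) + sqrt (card {x \<in> A. M + int k + 2 \<le> g x})"
proof -
  define q where "q = card {x \<in> A. g x > M + int k}"
  define r where "r = card {x \<in> A. M + int k + 2 \<le> g x}"
  have "{x \<in> A. g x > M + int (Suc k)} = {x \<in> A. M + int k + 2 \<le> g x}" by auto
  hence qr: "q < 2 * r" using slow by (simp add: q_def r_def)
  have "q \<le> card {x \<in> A. g x > M}" unfolding q_def using fin by (intro card_mono) auto
  hence qA: "2 * q \<le> card A" using half by simp
  have "{x \<in> A. g x \<le> M + int k} = A - {x \<in> A. g x > M + int k}" by auto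
  hence c: "card {x \<in> A. g x \<le> M + int k} = card A - q"
    using fin by (simp add: card_Diff_subset q_def)
  show "{x \<in> A. M + int k + 2 \<le> g x} \<noteq> {}" using qr unfolding r_def by (metis card.empty mult_0_right not_less_zero)
  hence "card A > 0" using fin by (auto simp: card_gt_0_iff)
  hence "card A - q > 0" using qA by linarith
  thus "{x \<in> A. g x \<le> M + int k} \<noteq> {}" using c by (metis card.empty less_irrefl)
  have "sqrt (card A) \<le> sqrt (real (card A) - real q) + sqrt r"
    using qr qA by (intro sqrt_le_add_sqrt_split) auto
  thus "sqrt (card A) \<le> sqrt (card {x \<in> A. g x \<le> M + int k})
      + sqrt (card {x \<in> A. M + int k + 2 \<le> g x})"
    using c qA by (simp add: r_def of_nat_diff)
qed

text \<open>Without a cut on either side of the median, both one-sided second moments would be at most \<open>3\<close>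
  per point. As \<open>(u - v)\<^sup>2 \<le> 2 u\<^sup>2 + 2 v\<^sup>2\<close>, the mean square difference over pairs would then be at most
  \<open>4 * (3 + 3) = 24\<close>.\<close>

lemma spread_coordinate_split:
  fixes g :: "'a \<Rightarrow> int"
  assumes fin: "finite A"
    and spread: "(\<Sum>x\<in>A. \<Sum>y\<in>A. (real_of_int (g x - g y))^2) > 24 * (real (card A))^2"
  obtains a where "{x \<in> A. g x \<le> a} \<noteq> {}" "{x \<in> A. a + 2 \<le> g x} \<noteq> {}"
    "sqrt (card A) \<le> sqrt (card {x \<in> A. g x \<le> a}) + sqrt (card {x \<in> A. a + 2 \<le> g x})"
proof -
  obtain M where up: "2 * card {x \<in> A. g x > M} \<le> card A"
    and down: "2 * card {x \<in> A. g x < M} \<le> card A"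
    using int_median_exists[OF fin, of g] by blast
  \<comment> \<open>The lower tail of \<open>g\<close> is the upper tail of \<open>- g\<close> about the median \<open>- M\<close>.\<close>
  have down': "2 * card {x \<in> A. - g x > - M} \<le> card A" using down by simp
  show thesis
  proof (cases "\<exists>k. \<not> 2 * card {x \<in> A. g x > M + int (Suc k)} \<le> card {x \<in> A. g x > M + int k}")
    case True
    then obtain k where "\<not> 2 * card {x \<in> A. g x > M + int (Suc k)} \<le> card {x \<in> A. g x > M + int k}" ..
    from slow_tail_split[OF fin up this] show thesis by (rule that)
  next
    case no_up: False
    show thesis
    proof (cases "\<exists>k. \<not> 2 * card {x \<in> A. - g x > - M + int (Suc k)} \<le> card {x \<in> A. - g x > - M + int k}")
      case True
      then obtain k where
        "\<not> 2 * card {x \<in> A. - g x > - M + int (Suc k)} \<le> card {x \<in> A. - g x > - M + int k}" ..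
      note s = slow_tail_split[OF fin down' this]
      have e1: "{x \<in> A. - g x \<le> - M + int k} = {x \<in> A. (M - int k - 2) + 2 \<le> g x}" by auto
      have e2: "{x \<in> A. - M + int k + 2 \<le> - g x} = {x \<in> A. g x \<le> M - int k - 2}" by auto
      show thesis using s unfolding e1 e2 by (intro that) (auto simp: add.commute)
    next
      case no_down: False
      have "(\<Sum>x\<in>A. (real (nat (g x - M)))^2) \<le> 3 * real (card A)"
        by (rule geometric_tail_second_moment[OF fin up]) (use no_up in blast)
      moreover have "(\<Sum>x\<in>A. (real (nat (- g x - - M)))^2) \<le> 3 * real (card A)"
        by (rule geometric_tail_second_moment[OF fin down']) (use no_down in blast)
      moreover have "(real_of_int (g x - M))^2
          = (real (nat (g x - M)))^2 + (real (nat (- g x - - M)))^2" for x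
        by (cases "g x \<ge> M") (auto simp: power2_commute)
      ultimately have V: "(\<Sum>x\<in>A. (real_of_int (g x - M))^2) \<le> 6 * real (card A)"
        by (simp add: sum.distrib)
      have "(\<Sum>x\<in>A. \<Sum>y\<in>A. (real_of_int (g x - g y))^2)
          \<le> (\<Sum>x\<in>A. \<Sum>y\<in>A. 2 * (real_of_int (g x - M))^2 + 2 * (real_of_int (g y - M))^2)"
      proof (intro sum_mono)
        fix x y
        have "(u - v)^2 \<le> 2 * u^2 + 2 * v^2" for u v :: real
          using zero_le_power2[of "u + v"] by (simp add: power2_sum power2_diff)
        from this[of "real_of_int (g x - M)" "real_of_int (g y - M)"]
        show "(real_of_int (g x - g y))^2
            \<le> 2 * (real_of_int (g x - M))^2 + 2 * (real_of_int (g y - M))^2" by simp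
      qed
      also have "\<dots> = 4 * real (card A) * (\<Sum>x\<in>A. (real_of_int (g x - M))^2)"
        by (simp add: sum.distrib sum_distrib_left[symmetric])
      also have "\<dots> \<le> 4 * real (card A) * (6 * real (card A))"
        using V by (intro mult_left_mono) auto
      finally show thesis using spread by (simp add: power2_eq_square)
    qed
  qed
qed

section \<open>Separated sets shatter many cubes\<close>

text \<open>Rounding down moves a value by less than one unit, so a gap of two units between rounded values
  leaves a gap of at least one unit between the original ones.\<close>

definition shatters :: "('a \<Rightarrow> 'b \<Rightarrow> int) \<Rightarrow> 'a set \<Rightarrow> 'b set \<Rightarrow> ('b \<Rightarrow> int) \<Rightarrow> bool" where
  "shatters Y A s h \<longleftrightarrow>
     (\<forall>u\<subseteq>s. \<exists>x\<in>A. (\<forall>i\<in>u. Y x i \<le> h i) \<and> (\<forall>i\<in>s - u. h i + 2 \<le> Y x i))"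

text \<open>The levels are extensional functions, so that different pairs describe different cubes and the
  cubes can be counted.\<close>

definition shattered_cubes ::
  "'b set \<Rightarrow> int \<Rightarrow> ('a \<Rightarrow> 'b \<Rightarrow> int) \<Rightarrow> 'a set \<Rightarrow> ('b set \<times> ('b \<Rightarrow> int)) set" where
  "shattered_cubes I p Y A = {(s, h). s \<subseteq> I \<and> h \<in> s \<rightarrow>\<^sub>E {0..<p} \<and> shatters Y A s h}"

lemma finite_shattered_cubes: "finite I \<Longrightarrow> finite (shattered_cubes I p Y A)"
proof -
  assume fin: "finite I"
  have "finite (s \<rightarrow>\<^sub>E {0..<p})" if "s \<in> Pow I" for s
    using that fin by (intro finite_PiE) (auto intro: finite_subset)
  hence "finite (Sigma (Pow I) (\<lambda>s. s \<rightarrow>\<^sub>E {0..<p}))"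
    using fin by (intro finite_SigmaI) auto
  moreover have "shattered_cubes I p Y A \<subseteq> Sigma (Pow I) (\<lambda>s. s \<rightarrow>\<^sub>E {0..<p})"
    by (auto simp: shattered_cubes_def)
  ultimately show ?thesis by (rule rev_finite_subset)
qed

lemma shatters_mono: "A \<subseteq> A' \<Longrightarrow> shatters Y A s h \<Longrightarrow> shatters Y A' s h"
  unfolding shatters_def by (meson subsetD)

lemma shatters_low: "shatters Y A s h \<Longrightarrow> i \<in> s \<Longrightarrow> \<exists>x\<in>A. Y x i \<le> h i"
  unfolding shatters_def by (drule spec[of _ s]) auto

lemma shatters_high: "shatters Y A s h \<Longrightarrow> i \<in> s \<Longrightarrow> \<exists>x\<in>A. h i + 2 \<le> Y x i"
  unfolding shatters_def by (drule spec[of _ "{}"]) auto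

text \<open>The patterns that are low at the new coordinate are taken from \<open>A1\<close>, the others from \<open>A2\<close>.\<close>

lemma shatters_insert:
  assumes "i \<notin> s" and sh1: "shatters Y A1 s h" and sh2: "shatters Y A2 s h"
    and "A1 \<subseteq> A" "A2 \<subseteq> A"
    and "\<And>x. x \<in> A1 \<Longrightarrow> Y x i \<le> a" and "\<And>x. x \<in> A2 \<Longrightarrow> a + 2 \<le> Y x i"
  shows "shatters Y A (insert i s) (h(i := a))"
  unfolding shatters_def
proof (intro allI impI)
  fix u assume u: "u \<subseteq> insert i s"
  have us: "u - {i} \<subseteq> s" using u by blast
  show "\<exists>x\<in>A. (\<forall>j\<in>u. Y x j \<le> (h(i := a)) j) \<and> (\<forall>j\<in>insert i s - u. (h(i := a)) j + 2 \<le> Y x j)"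
  proof (cases "i \<in> u")
    case True
    obtain x where "x \<in> A1" "\<forall>j\<in>u - {i}. Y x j \<le> h j" "\<forall>j\<in>s - (u - {i}). h j + 2 \<le> Y x j"
      using sh1 us unfolding shatters_def by blast
    thus ?thesis using assms True by (intro bexI[of _ x]) auto
  next
    case False
    obtain x where "x \<in> A2" "\<forall>j\<in>u - {i}. Y x j \<le> h j" "\<forall>j\<in>s - (u - {i}). h j + 2 \<le> Y x j"
      using sh2 us unfolding shatters_def by blast
    thus ?thesis using assms False by (intro bexI[of _ x]) auto
  qed
qed

text \<open>The cubes shattered by only one of the two parts count once on both sides. A cube shattered by
  both does not use the coordinate \<open>i\<close>, because no level lies both low enough for \<open>A1\<close> and
  high enough for \<open>A2\<close>; so it can be extended by \<open>(i, a)\<close>. The extended cube is a second one for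
  \<open>A\<close>, and neither part shatters it, as each lies on one side of \<open>a\<close>.\<close>

lemma card_shattered_cubes_superadditive:
  assumes fin: "finite I" and i: "i \<in> I" and a: "0 \<le> a" "a < p"
    and sub: "A1 \<subseteq> A" "A2 \<subseteq> A"
    and A1: "\<And>x. x \<in> A1 \<Longrightarrow> Y x i \<le> a" and A2: "\<And>x. x \<in> A2 \<Longrightarrow> a + 2 \<le> Y x i"
  shows "card (shattered_cubes I p Y A1) + card (shattered_cubes I p Y A2)
    \<le> card (shattered_cubes I p Y A)"
proof -
  let ?S = "shattered_cubes I p Y"
  let ?E = "\<lambda>(s, h). (insert i s, h(i := a))"
  have notin: "i \<notin> s" if "(s, h) \<in> ?S A1" "(s, h) \<in> ?S A2" for s h
  proof
    assume m: "i \<in> s"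
    have sh: "shatters Y A1 s h" "shatters Y A2 s h" using that by (auto simp: shattered_cubes_def)
    from shatters_high[OF sh(1) m] shatters_low[OF sh(2) m] show False using A1 A2 by fastforce
  qed
  have inj: "inj_on ?E (?S A1 \<inter> ?S A2)"
  proof (rule inj_onI, clarify)
    fix s h s' h'
    assume *: "(s, h) \<in> ?S A1" "(s, h) \<in> ?S A2" "(s', h') \<in> ?S A1" "(s', h') \<in> ?S A2"
      and eq: "insert i s = insert i s'" "h(i := a) = h'(i := a)"
    have ni: "i \<notin> s" "i \<notin> s'" using notin * by auto
    hence "s = s'" using eq by (metis insert_ident)
    moreover have "h i = h' i"
      using * ni by (auto simp: shattered_cubes_def PiE_iff extensional_def)
    hence "h = h'" using eq(2) by (metis fun_upd_triv fun_upd_upd)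
    ultimately show "s = s' \<and> h = h'" by simp
  qed
  have ext: "?E ` (?S A1 \<inter> ?S A2) \<subseteq> ?S A"
  proof clarify
    fix s h assume *: "(s, h) \<in> ?S A1" "(s, h) \<in> ?S A2"
    have "shatters Y A (insert i s) (h(i := a))"
      using * notin[OF *] sub A1 A2
      by (intro shatters_insert[of i s Y A1 h A2]) (auto simp: shattered_cubes_def)
    moreover have "h(i := a) \<in> insert i s \<rightarrow>\<^sub>E {0..<p}"
      using * a by (auto simp: shattered_cubes_def PiE_iff extensional_def)
    ultimately show "(insert i s, h(i := a)) \<in> ?S A"
      using * i by (auto simp: shattered_cubes_def)
  qed
  have disj: "?E ` (?S A1 \<inter> ?S A2) \<inter> (?S A1 \<union> ?S A2) = {}"
  proof -
    have "(insert i s, h(i := a)) \<notin> ?S A1" for s h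
      using shatters_high[of Y A1 "insert i s" "h(i := a)" i] A1
      by (fastforce simp: shattered_cubes_def)
    moreover have "(insert i s, h(i := a)) \<notin> ?S A2" for s h
      using shatters_low[of Y A2 "insert i s" "h(i := a)" i] A2
      by (fastforce simp: shattered_cubes_def)
    ultimately show ?thesis by fast
  qed
  have un: "?S A1 \<union> ?S A2 \<subseteq> ?S A"
    using shatters_mono[OF sub(1)] shatters_mono[OF sub(2)] by (auto simp: shattered_cubes_def)
  note [simp] = finite_shattered_cubes[OF fin]
  have "card (?S A1) + card (?S A2) = card (?S A1 \<union> ?S A2) + card (?S A1 \<inter> ?S A2)"
    by (rule card_Un_Int) simp_all
  also have "\<dots> = card (?S A1 \<union> ?S A2) + card (?E ` (?S A1 \<inter> ?S A2))"
    using inj by (simp add: card_image)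
  also have "\<dots> = card ((?S A1 \<union> ?S A2) \<union> ?E ` (?S A1 \<inter> ?S A2))"
    by (rule card_Un_disjoint[symmetric, OF _ _ disj[unfolded Int_commute[of "?E ` _"]]]) simp_all
  also have "\<dots> \<le> card (?S A)" using un ext by (intro card_mono) simp_all
  finally show ?thesis .
qed

text \<open>Averaging over the coordinates and over all pairs: distinct pairs are at least half of all pairs,
  which leaves \<open>49 / 2 > 24\<close>.\<close>

lemma separated_imp_spread_coordinate:
  fixes Y :: "'a \<Rightarrow> 'b \<Rightarrow> int"
  assumes fin: "finite A" "finite I" and I: "I \<noteq> {}" and two: "card A \<ge> 2"
    and sep: "\<And>x y. x \<in> A \<Longrightarrow> y \<in> A \<Longrightarrow> x \<noteq> y \<Longrightarrow>
      49 * real (card I) \<le> (\<Sum>i\<in>I. (real_of_int (Y x i - Y y i))^2)"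
  shows "\<exists>i\<in>I. (\<Sum>x\<in>A. \<Sum>y\<in>A. (real_of_int (Y x i - Y y i))^2) > 24 * (real (card A))^2"
proof (rule ccontr)
  assume "\<not> ?thesis"
  hence le: "(\<Sum>x\<in>A. \<Sum>y\<in>A. (real_of_int (Y x i - Y y i))^2) \<le> 24 * (real (card A))^2"
    if "i \<in> I" for i using that by (auto simp: not_less)
  let ?N = "real (card A)" and ?m = "real (card I)"
  have m: "?m > 0" using fin I by (simp add: card_gt_0_iff)
  have "?N * ((?N - 1) * (49 * ?m)) = (\<Sum>x\<in>A. \<Sum>y\<in>A - {x}. 49 * ?m)"
    using fin two by (simp add: card_Diff_singleton_if of_nat_diff)
  also have "\<dots> \<le> (\<Sum>x\<in>A. \<Sum>y\<in>A - {x}. \<Sum>i\<in>I. (real_of_int (Y x i - Y y i))^2)"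
    using sep by (intro sum_mono) auto
  also have "\<dots> \<le> (\<Sum>x\<in>A. \<Sum>y\<in>A. \<Sum>i\<in>I. (real_of_int (Y x i - Y y i))^2)"
    using fin by (intro sum_mono sum_mono2) (auto intro: sum_nonneg)
  also have "\<dots> = (\<Sum>x\<in>A. \<Sum>i\<in>I. \<Sum>y\<in>A. (real_of_int (Y x i - Y y i))^2)"
    by (intro sum.cong refl) (rule sum.swap)
  also have "\<dots> = (\<Sum>i\<in>I. \<Sum>x\<in>A. \<Sum>y\<in>A. (real_of_int (Y x i - Y y i))^2)"
    by (rule sum.swap)
  also have "\<dots> \<le> (\<Sum>i\<in>I. 24 * ?N^2)" using le by (intro sum_mono) auto
  also have "\<dots> = ?m * (24 * ?N^2)" by simp
  finally have "(49 * (?N - 1)) * (?N * ?m) \<le> (24 * ?N) * (?N * ?m)"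
    by (simp add: power2_eq_square algebra_simps)
  moreover have "0 < ?N * ?m" using m two by simp
  ultimately have "49 * (?N - 1) \<le> 24 * ?N" by (simp only: mult_le_cancel_right_pos)
  thus False using two by simp
qed

text \<open>Cutting \<open>A\<close> repeatedly does not decrease the sum of the square roots of the sizes of the parts, and
  at the end each single point shatters the empty cube.\<close>

lemma sqrt_card_le_card_shattered_cubes:
  fixes Y :: "'a \<Rightarrow> 'b \<Rightarrow> int"
  assumes "finite A" "A \<noteq> {}" and fin: "finite I" and I: "I \<noteq> {}"
    and "\<And>x i. x \<in> A \<Longrightarrow> i \<in> I \<Longrightarrow> 0 \<le> Y x i \<and> Y x i \<le> p"
    and "\<And>x y. x \<in> A \<Longrightarrow> y \<in> A \<Longrightarrow> x \<noteq> y \<Longrightarrow>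
      49 * real (card I) \<le> (\<Sum>i\<in>I. (real_of_int (Y x i - Y y i))^2)"
  shows "sqrt (card A) \<le> card (shattered_cubes I p Y A)"
  using assms(1,2,5,6)
proof (induction "card A" arbitrary: A rule: less_induct)
  case less
  note finA = less.prems(1) and ne = less.prems(2) and range = less.prems(3) and sep = less.prems(4)
  let ?S = "shattered_cubes I p Y"
  show ?case
  proof (cases "card A \<ge> 2")
    case False
    have "card A > 0" using finA ne by (simp add: card_gt_0_iff)
    hence one: "card A = 1" using False by linarith
    have "({}, \<lambda>_. undefined) \<in> ?S A" using ne by (auto simp: shattered_cubes_def shatters_def)
    hence "card (?S A) \<noteq> 0" using finite_shattered_cubes[OF fin] by (metis card_0_eq empty_iff)
    thus ?thesis using one by simp
  next
    case True
    obtain i where i: "i \<in> I"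
      and spread: "(\<Sum>x\<in>A. \<Sum>y\<in>A. (real_of_int (Y x i - Y y i))^2) > 24 * (real (card A))^2"
      using separated_imp_spread_coordinate[OF finA fin I True, of Y] sep by blast
    obtain a where a: "{x \<in> A. Y x i \<le> a} \<noteq> {}" "{x \<in> A. a + 2 \<le> Y x i} \<noteq> {}"
      and split: "sqrt (card A) \<le> sqrt (card {x \<in> A. Y x i \<le> a}) + sqrt (card {x \<in> A. a + 2 \<le> Y x i})"
      by (rule spread_coordinate_split[OF finA spread])
    define L where "L = {x \<in> A. Y x i \<le> a}"
    define U where "U = {x \<in> A. a + 2 \<le> Y x i}"
    have sub: "L \<subseteq> A" "U \<subseteq> A" by (auto simp: L_def U_def)
    have ne': "L \<noteq> {}" "U \<noteq> {}" using a by (simp_all add: L_def U_def)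
    have "L \<inter> U = {}" by (auto simp: L_def U_def)
    hence "L \<subset> A" "U \<subset> A" using sub ne' by blast+
    hence less': "card L < card A" "card U < card A" using finA by (auto intro: psubset_card_mono)
    have a_range: "0 \<le> a" "a < p"
      using ne' range i by (fastforce simp: L_def U_def)+
    have IH: "sqrt (card X) \<le> card (?S X)" if "X \<subseteq> A" "X \<noteq> {}" "card X < card A" for X
      by (rule less.hyps[OF that(3) finite_subset[OF that(1) finA] that(2)])
        (use that(1) range sep in blast)+
    have "sqrt (card A) \<le> sqrt (card L) + sqrt (card U)" using split by (simp add: L_def U_def)
    also have "\<dots> \<le> real (card (?S L) + card (?S U))"
      using IH[of L] IH[of U] sub ne' less' by simp
    also have "\<dots> \<le> real (card (?S A))"
      using sub a_range
      by (intro of_nat_mono card_shattered_cubes_superadditive[OF fin i]) (auto simp: L_def U_def)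
    finally show ?thesis .
  qed
qed

section \<open>Counting cubes of bounded dimension\<close>

text \<open>Weighting a cube of dimension \<open>k\<close> by \<open>\<theta>\<^sup>k\<close> turns the count of the cubes of dimension at most \<open>d\<close>
  into a binomial sum over all cubes. The parameter \<open>\<theta>\<close> is free, which avoids any estimate of
  binomial coefficients.\<close>

lemma weighted_cube_count:
  fixes \<theta> :: real and R :: "'c set"
  assumes fin: "finite I" "finite R" and \<theta>: "0 < \<theta>" "\<theta> \<le> 1"
    and S: "S \<subseteq> (SIGMA s:{s. s \<subseteq> I \<and> card s \<le> d}. s \<rightarrow>\<^sub>E R)"
  shows "\<theta> ^ d * card S \<le> (1 + \<theta> * card R) ^ card I"
proof -
  let ?T = "{s. s \<subseteq> I \<and> card s \<le> d}"
  have finT: "finite ?T" using fin by (auto intro: finite_subset[of _ "Pow I"])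
  have fs: "finite s" if "s \<in> ?T" for s using that fin(1) by (auto intro: finite_subset)
  have fPiE: "finite (s \<rightarrow>\<^sub>E R)" if "s \<in> ?T" for s
    using fs[OF that] fin(2) by (rule finite_PiE)
  have "finite (SIGMA s:?T. s \<rightarrow>\<^sub>E R)" using finT fPiE by (rule finite_SigmaI)
  hence "card S \<le> card (SIGMA s:?T. s \<rightarrow>\<^sub>E R)" using S by (rule card_mono)
  also have "\<dots> = (\<Sum>s\<in>?T. card (s \<rightarrow>\<^sub>E R))"
    using finT fPiE by (intro card_SigmaI) blast+
  also have "\<dots> = (\<Sum>s\<in>?T. card R ^ card s)"
    using fs by (intro sum.cong refl) (simp add: card_PiE)
  finally have "real (card S) \<le> real (\<Sum>s\<in>?T. card R ^ card s)" by (rule of_nat_mono)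
  hence "\<theta> ^ d * card S \<le> \<theta> ^ d * (\<Sum>s\<in>?T. real (card R) ^ card s)"
    using \<theta> by (intro mult_left_mono) auto
  also have "\<dots> = (\<Sum>s\<in>?T. \<theta> ^ d * real (card R) ^ card s)" by (rule sum_distrib_left)
  also have "\<dots> \<le> (\<Sum>s\<in>?T. \<theta> ^ card s * real (card R) ^ card s)"
    using \<theta> by (intro sum_mono mult_right_mono power_decreasing) auto
  also have "\<dots> \<le> (\<Sum>s\<in>Pow I. \<theta> ^ card s * real (card R) ^ card s)"
    using fin \<theta> by (intro sum_mono2) auto
  also have "\<dots> = (\<Prod>i\<in>I. \<theta> * card R + 1)"
    by (subst prod_add[OF fin(1)]) (simp add: power_mult_distrib)
  finally show ?thesis by (simp add: add.commute)
qed

section \<open>Sampling coordinates\<close>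

lemma exp_neg_le: "exp (- z) \<le> 1 - z / 2" if "0 \<le> z" "z \<le> 1" for z :: real
proof -
  have "1 + z \<le> exp z" by (rule exp_ge_add_one_self)
  hence "exp (- z) \<le> inverse (1 + z)"
    using that by (simp add: exp_minus le_imp_inverse_le)
  also have "\<dots> \<le> 1 - z / 2"
  proof -
    have "z * z \<le> z * 1" using that by (intro mult_left_mono) auto
    thus ?thesis using that by (simp add: field_simps)
  qed
  finally show ?thesis .
qed

text \<open>A Chernoff bound by averaging over all maps \<open>\<phi>\<close>. The weight of a pair is the exponential of minus
  its sampled square distance. The average of this weight over all \<open>\<phi>\<close> factorizes over the \<open>m\<close> samples
  and is at most \<open>exp (- \<tau> m / 2)\<close>, so for some \<open>\<phi>\<close> all pairs together have weight at most \<open>N\<^sup>2\<close>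
  times this. No single pair can then be close.\<close>

lemma coordinate_sampling:
  fixes A :: "('b \<Rightarrow> real) set" and \<tau> :: real
  assumes fin: "finite A" "finite I" and I: "I \<noteq> {}" and A: "A \<noteq> {}"
    and range: "\<And>x i. x \<in> A \<Longrightarrow> i \<in> I \<Longrightarrow> 0 \<le> x i \<and> x i \<le> 1"
    and sep: "\<And>x y. x \<in> A \<Longrightarrow> y \<in> A \<Longrightarrow> x \<noteq> y \<Longrightarrow> \<tau> * card I \<le> (\<Sum>i\<in>I. (x i - y i)^2)"
    and m: "8 * ln (card A) \<le> \<tau> * real m"
  shows "\<exists>\<phi>. (\<forall>j<m. \<phi> j \<in> I) \<and>
    (\<forall>x\<in>A. \<forall>y\<in>A. x \<noteq> y \<longrightarrow> \<tau> / 4 * real m \<le> (\<Sum>j<m. (x (\<phi> j) - y (\<phi> j))^2))"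
proof -
  let ?n = "real (card I)" and ?N = "real (card A)"
  let ?Phi = "{..<m} \<rightarrow>\<^sub>E I"
  let ?D = "{(x, y) \<in> A \<times> A. x \<noteq> y}"
  let ?w = "\<lambda>(x, y) \<phi>. exp (- (\<Sum>j<m. (x (\<phi> j) - y (\<phi> j))^2)) :: real"
  have n: "?n > 0" using fin I by (simp add: card_gt_0_iff)
  have N: "?N > 0" using fin A by (simp add: card_gt_0_iff)
  have finD: "finite ?D" using fin by (auto intro: finite_subset[of _ "A \<times> A"])
  have cardD: "real (card ?D) \<le> ?N^2"
  proof -
    have "card ?D \<le> card (A \<times> A)" using fin by (intro card_mono) auto
    thus ?thesis by (simp add: card_cartesian_product power2_eq_square flip: of_nat_mult)
  qed
  have pair: "(\<Sum>\<phi>\<in>?Phi. ?w xy \<phi>) \<le> ?n ^ m * exp (- (\<tau> * m / 2))" if D: "xy \<in> ?D" for xy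
  proof -
    obtain x y where xy: "xy = (x, y)" "x \<in> A" "y \<in> A" "x \<noteq> y"
      using D by blast
    have "(\<Sum>i\<in>I. exp (- ((x i - y i)^2))) \<le> (\<Sum>i\<in>I. 1 - (x i - y i)^2 / 2)"
    proof (intro sum_mono exp_neg_le)
      fix i assume "i \<in> I"
      hence "\<bar>x i - y i\<bar> \<le> 1" using range[OF xy(2)] range[OF xy(3)] by (smt (verit))
      thus "(x i - y i)^2 \<le> 1" by (simp add: abs_square_le_1)
    qed simp
    also have "\<dots> = ?n - (\<Sum>i\<in>I. (x i - y i)^2) / 2"
      by (simp add: sum_subtractf sum_divide_distrib)
    also have "\<dots> \<le> ?n * (1 - \<tau> / 2)" using sep[OF xy(2-4)] by (simp add: algebra_simps)
    also have "\<dots> \<le> ?n * exp (- (\<tau> / 2))"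
      using exp_ge_add_one_self[of "- (\<tau> / 2)"] by (intro mult_left_mono) auto
    finally have le: "(\<Sum>i\<in>I. exp (- ((x i - y i)^2))) \<le> ?n * exp (- (\<tau> / 2))" .
    have "(\<Sum>\<phi>\<in>?Phi. ?w xy \<phi>) = (\<Sum>\<phi>\<in>?Phi. \<Prod>j<m. exp (- ((x (\<phi> j) - y (\<phi> j))^2)))"
      by (simp add: xy exp_sum flip: sum_negf)
    also have "\<dots> = (\<Prod>j<m. \<Sum>i\<in>I. exp (- ((x i - y i)^2)))"
      using fin by (intro prod_sum_PiE[symmetric]) auto
    also have "\<dots> = (\<Sum>i\<in>I. exp (- ((x i - y i)^2))) ^ m" by simp
    also have "\<dots> \<le> (?n * exp (- (\<tau> / 2))) ^ m"
      using le by (intro power_mono sum_nonneg) auto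
    also have "\<dots> = ?n ^ m * exp (- (\<tau> * m / 2))"
      by (simp add: power_mult_distrib mult_ac flip: exp_of_nat_mult)
    finally show ?thesis .
  qed
  have "(\<Sum>\<phi>\<in>?Phi. \<Sum>xy\<in>?D. ?w xy \<phi>) = (\<Sum>xy\<in>?D. \<Sum>\<phi>\<in>?Phi. ?w xy \<phi>)" by (rule sum.swap)
  also have "\<dots> \<le> (\<Sum>xy\<in>?D. ?n ^ m * exp (- (\<tau> * m / 2)))" using pair by (rule sum_mono)
  also have "\<dots> \<le> ?N^2 * (?n ^ m * exp (- (\<tau> * m / 2)))"
    using cardD by (simp add: mult_right_mono)
  also have "\<dots> = (\<Sum>\<phi>\<in>?Phi. ?N^2 * exp (- (\<tau> * m / 2)))"
    by (simp add: card_PiE)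
  finally have avg: "(\<Sum>\<phi>\<in>?Phi. \<Sum>xy\<in>?D. ?w xy \<phi>) \<le> (\<Sum>\<phi>\<in>?Phi. ?N^2 * exp (- (\<tau> * m / 2)))" .
  have "?Phi \<noteq> {}" "finite ?Phi" using I fin by (auto simp: PiE_eq_empty_iff intro!: finite_PiE)
  hence "\<exists>\<phi>\<in>?Phi. (\<Sum>xy\<in>?D. ?w xy \<phi>) \<le> ?N^2 * exp (- (\<tau> * m / 2))"
    using avg sum_strict_mono[of ?Phi "\<lambda>\<phi>. ?N^2 * exp (- (\<tau> * m / 2))"
        "\<lambda>\<phi>. \<Sum>xy\<in>?D. ?w xy \<phi>"] by (metis (no_types, lifting) not_le)
  then obtain \<phi> where \<phi>: "\<phi> \<in> ?Phi"
    and small: "(\<Sum>xy\<in>?D. ?w xy \<phi>) \<le> ?N^2 * exp (- (\<tau> * m / 2))" ..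
  have "\<tau> / 4 * real m \<le> (\<Sum>j<m. (x (\<phi> j) - y (\<phi> j))^2)"
    if xy: "x \<in> A" "y \<in> A" "x \<noteq> y" for x y
  proof -
    have "?w (x, y) \<phi> \<le> (\<Sum>xy\<in>?D. ?w xy \<phi>)"
      using xy finD by (intro member_le_sum) auto
    also note small
    also have "?N^2 = exp (2 * ln ?N)" using N by (simp add: exp_double)
    also have "exp (2 * ln ?N) * exp (- (\<tau> * m / 2)) = exp (2 * ln ?N - \<tau> * m / 2)"
      by (simp flip: exp_add)
    finally show ?thesis using m by simp
  qed
  thus ?thesis using \<phi> by (intro exI[of _ \<phi>]) auto
qed

section \<open>Convexity turns shattering into cubes\<close>

text \<open>The coordinates are adjusted one at a time: between a point low at \<open>j\<close> and a point high at \<open>j\<close>, both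
  with the same pattern elsewhere, the segment contains a point whose coordinate \<open>j\<close> is exactly \<open>z j\<close>,
  and the pattern elsewhere survives. Therefore the convex slice of \<open>C\<close> at \<open>z j\<close> again satisfies the
  hypothesis for the remaining coordinates.\<close>

lemma convex_meets_prescribed_coordinates:
  fixes C :: "('b \<Rightarrow> real) set"
  assumes "finite s" "convex C"
    and "\<And>u. u \<subseteq> s \<Longrightarrow> \<exists>x\<in>C. (\<forall>i\<in>u. x i \<le> z i) \<and> (\<forall>i\<in>s - u. z i \<le> x i)"
  shows "\<exists>x\<in>C. \<forall>i\<in>s. x i = z i"
  using assms
proof (induction s arbitrary: C rule: finite_induct)
  case empty
  thus ?case by auto
next
  case (insert j s)
  let ?C = "{x \<in> C. x j = z j}"
  have "convex ?C"
    using \<open>convex C\<close> unfolding convex_def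
    by (auto simp: scaleR_fun_def plus_fun_def simp flip: distrib_right)
  moreover have "\<exists>x\<in>?C. (\<forall>i\<in>u. x i \<le> z i) \<and> (\<forall>i\<in>s - u. z i \<le> x i)" if u: "u \<subseteq> s" for u
  proof -
    obtain x where x: "x \<in> C" "\<forall>i\<in>insert j u. x i \<le> z i" "\<forall>i\<in>insert j s - insert j u. z i \<le> x i"
      using insert.prems(2)[of "insert j u"] u by blast
    obtain y where y: "y \<in> C" "\<forall>i\<in>u. y i \<le> z i" "\<forall>i\<in>insert j s - u. z i \<le> y i"
      using insert.prems(2)[of u] u by blast
    have jx: "x j \<le> z j" and jy: "z j \<le> y j" using x y u insert.hyps by auto
    obtain w where w: "0 \<le> w" "w \<le> 1" "(1 - w) * x j + w * y j = z j"
    proof (cases "x j = y j")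
      case True thus ?thesis using that[of 0] jx jy by simp
    next
      case False
      hence pos: "y j - x j > 0" using jx jy by simp
      let ?w = "(z j - x j) / (y j - x j)"
      have "(1 - ?w) * x j + ?w * y j = x j + ?w * (y j - x j)" by (simp only: left_diff_distrib right_diff_distrib mult_1)
      also have "\<dots> = z j" using pos by simp
      finally show ?thesis using jx jy pos by (intro that[of ?w]) auto
    qed
    let ?v = "(1 - w) *\<^sub>R x + w *\<^sub>R y"
    have v: "?v i = (1 - w) * x i + w * y i" for i by (simp add: scaleR_fun_def plus_fun_def)
    have "?v \<in> ?C" using \<open>convex C\<close> x(1) y(1) w v by (auto simp: convex_alt)
    moreover have "?v i \<le> z i" if "i \<in> u" for i
    proof -
      have "x i \<le> z i" "y i \<le> z i" using x y that by auto
      thus ?thesis unfolding v using w by (intro convex_bound_le) auto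
    qed
    moreover have "z i \<le> ?v i" if i: "i \<in> s - u" for i
    proof -
      have "i \<noteq> j" using i insert.hyps by auto
      hence "z i \<le> x i" "z i \<le> y i" using x y i by auto
      hence "(1 - w) * z i + w * z i \<le> ?v i"
        unfolding v using w by (intro add_mono mult_left_mono) auto
      thus ?thesis by (simp add: algebra_simps)
    qed
    ultimately show ?thesis by (intro bexI[of _ ?v]) auto
  qed
  ultimately have "\<exists>x\<in>?C. \<forall>i\<in>s. x i = z i" by (rule insert.IH)
  thus ?case by auto
qed

lemma translated_cube_subset_coord_proj:
  assumes "finite s" "convex B"
    and orth: "\<And>u. u \<subseteq> s \<Longrightarrow> \<exists>x\<in>B. (\<forall>i\<in>u. x i \<le> h i) \<and> (\<forall>i\<in>s - u. h i + a \<le> x i)"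
  shows "(+) (coord_proj s h) ` cube s a \<subseteq> coord_proj s ` B"
proof clarify
  fix q assume q: "q \<in> cube s a"
  let ?z = "coord_proj s h + q"
  have zi: "?z i = h i + q i" if "i \<in> s" for i using that by (simp add: coord_proj_def plus_fun_def)
  have qi: "0 \<le> q i" "q i \<le> a" if "i \<in> s" for i using q that by (auto simp: cube_def)
  have "\<exists>x\<in>B. \<forall>i\<in>s. x i = ?z i"
  proof (rule convex_meets_prescribed_coordinates[OF assms(1,2)])
    fix u assume u: "u \<subseteq> s"
    obtain x where x: "x \<in> B" "\<forall>i\<in>u. x i \<le> h i" "\<forall>i\<in>s - u. h i + a \<le> x i"
      using orth[OF u] by blast
    have "x i \<le> ?z i" if "i \<in> u" for i
      using x(2) that u qi[of i] zi[of i] by fastforce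
    moreover have "?z i \<le> x i" if "i \<in> s - u" for i
    proof -
      have "h i + a \<le> x i" "q i \<le> a" "?z i = h i + q i" using x(3) that qi zi by auto
      thus ?thesis by linarith
    qed
    ultimately show "\<exists>x\<in>B. (\<forall>i\<in>u. x i \<le> ?z i) \<and> (\<forall>i\<in>s - u. ?z i \<le> x i)"
      using x(1) by blast
  qed
  then obtain x where x: "x \<in> B" "\<forall>i\<in>s. x i = ?z i" by blast
  have "?z = coord_proj s x"
    using x(2) q by (auto simp: coord_proj_def cube_def coord_subspace_def plus_fun_def fun_eq_iff)
  thus "?z \<in> coord_proj s ` B" using x(1) by blast
qed

lemma card_le_max_cube_dim:
  assumes s: "s \<subseteq> {..<n}" and "convex B"
    and orth: "\<And>u. u \<subseteq> s \<Longrightarrow> \<exists>x\<in>B. (\<forall>i\<in>u. x i \<le> h i) \<and> (\<forall>i\<in>s - u. h i + a \<le> x i)"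
  shows "card s \<le> max_cube_dim n B a"
  unfolding max_cube_dim_def
proof (rule Max_ge)
  show "finite {card s |s. s \<subseteq> {..<n} \<and>
      (\<exists>h\<in>coord_subspace s. (+) h ` cube s a \<subseteq> coord_proj s ` B)}"
    by (rule finite_subset[of _ "card ` Pow {..<n}"]) auto
  have "coord_proj s h \<in> coord_subspace s" by (simp add: coord_proj_def coord_subspace_def)
  moreover have "(+) (coord_proj s h) ` cube s a \<subseteq> coord_proj s ` B"
    using finite_subset[OF s] assms(2) orth by (intro translated_cube_subset_coord_proj) auto
  ultimately show "card s \<in> {card s |s. s \<subseteq> {..<n} \<and>
      (\<exists>h\<in>coord_subspace s. (+) h ` cube s a \<subseteq> coord_proj s ` B)}"
    using s by blast
qed

section \<open>Separated sets and covering numbers\<close>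

text \<open>Euclidean distance at least \<open>r \<surd>n\<close>, squared: in this form the average over the coordinates can be
  compared with the average over a sample.\<close>

definition separated :: "nat \<Rightarrow> real \<Rightarrow> (nat \<Rightarrow> real) set \<Rightarrow> bool" where
  "separated n r A \<longleftrightarrow> (\<forall>x\<in>A. \<forall>y\<in>A. x \<noteq> y \<longrightarrow> r^2 * real n \<le> (\<Sum>i<n. (x i - y i)^2))"

text \<open>Rounding changes a difference by at most one unit, and \<open>(k + 1)\<^sup>2 \<le> (8 / 7) (k\<^sup>2 + 7)\<close>. These weights
  turn a mean square distance of \<open>64\<close> before rounding into \<open>49\<close> after it.\<close>

lemma floor_diff_square_ge:
  fixes u v :: real
  shows "(7 / 8) * (u - v)^2 - 7 \<le> (real_of_int (\<lfloor>u\<rfloor> - \<lfloor>v\<rfloor>))^2"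
proof -
  let ?k = "\<bar>real_of_int (\<lfloor>u\<rfloor> - \<lfloor>v\<rfloor>)\<bar>"
  have "\<bar>u - v\<bar> \<le> ?k + 1" by linarith
  hence "(u - v)^2 \<le> (?k + 1)^2" by (metis abs_ge_zero power_mono power2_abs)
  moreover have "0 \<le> (?k - 7)^2" by simp
  ultimately have "7 * (u - v)^2 \<le> 8 * ?k^2 + 56"
    by (simp only: power2_sum power2_diff) simp
  thus ?thesis by simp
qed

text \<open>Sampling may repeat a coordinate, but a shattered cube never uses two samples of the same one: a point
  would have to be low at one and high at the other, and a second point the other way round. So a
  shattered cube of the sample is a cube of the same dimension in the original coordinates.\<close>

lemma shattered_cube_dim_le:
  fixes t :: real
  assumes t: "t > 0" and s: "(s, h) \<in> shattered_cubes {..<m} p (\<lambda>x j. \<lfloor>16 * x (\<phi> j) / t\<rfloor>) A"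
    and \<phi>: "\<forall>j<m. \<phi> j < n"
    and d: "\<And>s h. s \<subseteq> {..<n} \<Longrightarrow>
      (\<And>u. u \<subseteq> s \<Longrightarrow> \<exists>x\<in>A. (\<forall>i\<in>u. x i \<le> h i) \<and> (\<forall>i\<in>s - u. h i + t / 16 \<le> x i)) \<Longrightarrow>
      card s \<le> d"
  shows "card s \<le> d"
proof -
  let ?Y = "\<lambda>x j. \<lfloor>16 * x (\<phi> j) / t\<rfloor>"
  have sm: "s \<subseteq> {..<m}" and sh: "shatters ?Y A s h" using s by (auto simp: shattered_cubes_def)
  have split: "\<exists>x\<in>A. (\<forall>j\<in>u. ?Y x j \<le> h j) \<and> (\<forall>j\<in>s - u. h j + 2 \<le> ?Y x j)" if "u \<subseteq> s" for u
    using sh that unfolding shatters_def by blast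
  have inj: "inj_on \<phi> s"
  proof (rule inj_onI, rule ccontr)
    fix j k assume jk: "j \<in> s" "k \<in> s" "\<phi> j = \<phi> k" "j \<noteq> k"
    obtain x where "x \<in> A" "?Y x j \<le> h j" "h k + 2 \<le> ?Y x k" 
      using split[of "{j}"] jk(1,2,4) by auto
    moreover obtain y where "y \<in> A" "?Y y k \<le> h k" "h j + 2 \<le> ?Y y j"
      using split[of "{k}"] jk(1,2,4) by auto
    ultimately show False using jk(3) by simp
  qed
  \<comment> \<open>A rounded value at most \<open>h\<close> is a value below \<open>h + 1\<close> units, whence the shift.\<close>
  define h' where "h' i = t / 16 * (real_of_int (h (inv_into s \<phi> i)) + 1)" for i
  have h': "h' (\<phi> j) = t / 16 * (real_of_int (h j) + 1)" if "j \<in> s" for j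
    using inj that by (simp add: h'_def)
  have "card (\<phi> ` s) \<le> d"
  proof (rule d)
    show "\<phi> ` s \<subseteq> {..<n}" using \<phi> sm by auto
  next
    fix u assume u: "u \<subseteq> \<phi> ` s"
    obtain x where x: "x \<in> A" "\<forall>j\<in>{j \<in> s. \<phi> j \<in> u}. ?Y x j \<le> h j"
      "\<forall>j\<in>s - {j \<in> s. \<phi> j \<in> u}. h j + 2 \<le> ?Y x j"
      using split[of "{j \<in> s. \<phi> j \<in> u}"] by auto
    have "x i \<le> h' i" if i: "i \<in> u" for i
    proof -
      obtain j where j: "j \<in> s" "i = \<phi> j" using i u by blast
      have "?Y x j \<le> h j" using x j i by blast
      hence "16 * x (\<phi> j) / t \<le> real_of_int (h j) + 1" by linarith
      thus ?thesis using t j by (simp add: h' field_simps)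
    qed
    moreover have "h' i + t / 16 \<le> x i" if i: "i \<in> \<phi> ` s - u" for i
    proof -
      obtain j where j: "j \<in> s" "i = \<phi> j" using i by blast
      have "h j + 2 \<le> ?Y x j" using x j i by blast
      hence "real_of_int (h j) + 2 \<le> 16 * x (\<phi> j) / t" by linarith
      thus ?thesis using t j by (simp add: h' field_simps)
    qed
    ultimately show "\<exists>x\<in>A. (\<forall>i\<in>u. x i \<le> h' i) \<and> (\<forall>i\<in>\<phi> ` s - u. h' i + t / 16 \<le> x i)"
      using x(1) by blast
  qed
  thus ?thesis using inj by (simp add: card_image)
qed

lemma card_separated_le:
  fixes t :: real
  assumes n: "n \<ge> 1" and t: "0 < t" "t < 1" and finA: "finite A"
    and range: "\<And>x i. x \<in> A \<Longrightarrow> i < n \<Longrightarrow> 0 \<le> x i \<and> x i \<le> 1"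
    and sep: "separated n t A"
    and d: "\<And>s h. s \<subseteq> {..<n} \<Longrightarrow>
      (\<And>u. u \<subseteq> s \<Longrightarrow> \<exists>x\<in>A. (\<forall>i\<in>u. x i \<le> h i) \<and> (\<forall>i\<in>s - u. h i + t / 16 \<le> x i)) \<Longrightarrow>
      card s \<le> d"
  shows "real (card A) \<le> (2 / t) ^ (40 * d)"
proof (cases "card A \<ge> 2")
  case False
  have "1 \<le> (2 / t) ^ (40 * d)" using t by (intro one_le_power) simp
  moreover have "real (card A) \<le> 1" using False by simp
  ultimately show ?thesis by linarith
next
  case True
  let ?l = "ln (real (card A))"
  have ne: "A \<noteq> {}" using True by auto
  have l: "?l \<ge> 1 / 2"
  proof -
    have "ln 2 \<le> ?l" using True by simp
    thus ?thesis using ln2_ge_two_thirds by linarith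
  qed
  \<comment> \<open>The least sample size allowed by \<open>coordinate_sampling\<close> with \<open>\<tau> = t\<^sup>2\<close>.\<close>
  define m where "m = nat \<lceil>8 * ?l / t^2\<rceil>"
  have m_ge: "8 * ?l / t^2 \<le> m" unfolding m_def by linarith
  have m_le: "m \<le> 10 * ?l / t^2"
  proof -
    have "m \<le> 8 * ?l / t^2 + 1" unfolding m_def using l t by (simp add: of_nat_nat)
    moreover have "1 \<le> 2 * ?l / t^2"
      using l t power_le_one[of t 2] by (simp add: field_simps)
    moreover have "8 * ?l / t^2 + 2 * ?l / t^2 = 10 * ?l / t^2" by (simp flip: add_divide_distrib)
    ultimately show ?thesis by linarith
  qed
  have m0: "m > 0"
  proof -
    have "0 < 8 * ?l / t^2" using l t by (intro divide_pos_pos) auto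
    thus ?thesis using m_ge by simp
  qed
  obtain \<phi> where \<phi>: "\<forall>j<m. \<phi> j \<in> {..<n}" and sep': "\<forall>x\<in>A. \<forall>y\<in>A. x \<noteq> y \<longrightarrow>
      t^2 / 4 * real m \<le> (\<Sum>j<m. (x (\<phi> j) - y (\<phi> j))^2)"
  proof -
    have "{..<n} \<noteq> {}" using n by (auto simp: lessThan_empty_iff)
    moreover have "8 * ?l \<le> t^2 * m" using m_ge t by (simp add: field_simps)
    ultimately show ?thesis
      using coordinate_sampling[OF finA, of "{..<n}" "t^2" m] ne range sep that
      by (auto simp: separated_def)
  qed
  define Y where "Y = (\<lambda>(x :: nat \<Rightarrow> real) j. \<lfloor>16 * x (\<phi> j) / t\<rfloor>)"
  let ?p = "\<lfloor>16 / t\<rfloor>"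
  let ?S = "shattered_cubes {..<m} ?p Y A"
  have "sqrt (card A) \<le> card ?S"
  proof (rule sqrt_card_le_card_shattered_cubes[OF finA ne])
    show "{..<m} \<noteq> {}" using m0 by (auto simp: lessThan_empty_iff)
  next
    fix x j assume xj: "x \<in> A" "j \<in> {..<m}"
    hence "0 \<le> x (\<phi> j)" "x (\<phi> j) \<le> 1" using range \<phi> by auto
    thus "0 \<le> Y x j \<and> Y x j \<le> ?p"
      using t by (auto simp: Y_def intro!: floor_mono divide_right_mono)
  next
    fix x y assume xy: "x \<in> A" "y \<in> A" "x \<noteq> y"
    \<comment> \<open>At half the scale the square distance is \<open>t\<^sup>2 / 4\<close> per sample, that is \<open>64\<close> square units of \<open>t / 16\<close>.\<close>
    have "64 * m = (16 / t)^2 * (t^2 / 4 * m)" using t by (simp add: field_simps)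
    also have "\<dots> \<le> (16 / t)^2 * (\<Sum>j<m. (x (\<phi> j) - y (\<phi> j))^2)"
      using sep' xy by (intro mult_left_mono) auto
    also have "\<dots> = (\<Sum>j<m. (16 * x (\<phi> j) / t - 16 * y (\<phi> j) / t)^2)"
      by (simp add: sum_distrib_left power_mult_distrib[symmetric] right_diff_distrib)
    finally have "49 * real m \<le> (7 / 8) * (\<Sum>j<m. (16 * x (\<phi> j) / t - 16 * y (\<phi> j) / t)^2) - 7 * m"
      by simp
    also have "\<dots> = (\<Sum>j<m. (7 / 8) * (16 * x (\<phi> j) / t - 16 * y (\<phi> j) / t)^2 - 7)"
      by (simp add: sum_subtractf sum_distrib_left)
    also have "\<dots> \<le> (\<Sum>j<m. (real_of_int (Y x j - Y y j))^2)"
      unfolding Y_def by (intro sum_mono floor_diff_square_ge)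
    finally show "49 * real (card {..<m}) \<le> (\<Sum>j<m. (real_of_int (Y x j - Y y j))^2)" by simp
  qed simp
  hence lower: "exp (?l / 2) \<le> card ?S"
  proof -
    have "exp (?l / 2) ^ 2 = card A" using True by (simp flip: exp_double)
    hence "exp (?l / 2) = sqrt (card A)" by (metis exp_ge_zero real_sqrt_unique)
    thus ?thesis using \<open>sqrt (card A) \<le> card ?S\<close> by simp
  qed
  \<comment> \<open>The exponent \<open>10\<close> gives \<open>160 / 2\<^sup>1\<^sup>0 \<le> 1 / 4\<close> below and \<open>t\<^sup>1\<^sup>0 \<le> t\<^sup>3\<close>, so that \<open>\<theta> P m \<le> (ln N) / 4\<close>
    for \<open>P \<le> 16 / t\<close> levels.\<close>
  define \<theta> where "\<theta> = (t / 2) ^ 10"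
  have \<theta>: "0 < \<theta>" "\<theta> \<le> 1" using t by (auto simp: \<theta>_def intro!: power_le_one)
  have "?S \<subseteq> (SIGMA s:{s. s \<subseteq> {..<m} \<and> card s \<le> d}. s \<rightarrow>\<^sub>E {0..<?p})"
  proof (rule subrelI)
    fix s h assume sh: "(s, h) \<in> ?S"
    have "card s \<le> d"
      by (rule shattered_cube_dim_le[OF t(1) sh[unfolded Y_def] _ d]) (use \<phi> in auto)
    thus "(s, h) \<in> (SIGMA s:{s. s \<subseteq> {..<m} \<and> card s \<le> d}. s \<rightarrow>\<^sub>E {0..<?p})"
      using sh by (auto simp: shattered_cubes_def)
  qed
  hence "\<theta> ^ d * card ?S \<le> (1 + \<theta> * card {0..<?p}) ^ card {..<m}"
    by (intro weighted_cube_count \<theta>) auto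
  also have "\<dots> \<le> exp (\<theta> * card {0..<?p}) ^ m"
    using \<theta> by (auto intro!: power_mono exp_ge_add_one_self)
  also have "\<dots> = exp (m * (\<theta> * card {0..<?p}))" by (simp add: exp_of_nat_mult)
  also have "\<dots> \<le> exp (?l / 4)"
  proof -
    have "real (card {0..<?p}) \<le> 16 / t" using t by (simp add: of_nat_nat)
    hence "m * (\<theta> * card {0..<?p}) \<le> (10 * ?l / t^2) * (\<theta> * (16 / t))"
      using m_le \<theta> l t by (intro mult_mono) auto
    also have "\<dots> = (160 / 1024) * (?l * t ^ 7)"
      using t by (simp add: \<theta>_def power_divide field_simps eval_nat_numeral)
    also have "\<dots> \<le> (160 / 1024) * (?l * 1)"
      using l t by (intro mult_left_mono power_le_one) auto
    also have "\<dots> \<le> ?l / 4" using l by simp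
    finally show ?thesis by simp
  qed
  finally have "\<theta> ^ d * card ?S \<le> exp (?l / 4)" .
  moreover have "\<theta> ^ d * exp (?l / 2) \<le> \<theta> ^ d * card ?S" using lower \<theta> by simp
  ultimately have "\<theta> ^ d * exp (?l / 2) \<le> exp (?l / 4)" by linarith
  moreover have "exp (?l / 2) = exp (?l / 4) * exp (?l / 4)" by (simp flip: exp_add)
  ultimately have "(\<theta> ^ d * exp (?l / 4)) * exp (?l / 4) \<le> 1 * exp (?l / 4)"
    by (simp only: mult.assoc mult_1)
  hence "\<theta> ^ d * exp (?l / 4) \<le> 1" by (simp only: mult_le_cancel_right_pos exp_gt_zero)
  hence "(\<theta> ^ d * exp (?l / 4)) ^ 4 \<le> 1" using \<theta> by (intro power_le_one) auto
  moreover have "exp (?l / 4) ^ 4 = card A" using True by (simp flip: exp_of_nat_mult)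
  moreover have "(\<theta> ^ d) ^ 4 = (t / 2) ^ (40 * d)" by (simp add: \<theta>_def mult_ac flip: power_mult)
  ultimately have "(t / 2) ^ (40 * d) * card A \<le> 1" by (simp add: power_mult_distrib)
  thus ?thesis using t by (simp add: power_divide field_simps)
qed

lemma exists_separated_net:
  assumes bound: "\<And>A. finite A \<Longrightarrow> A \<subseteq> B \<Longrightarrow> separated n r A \<Longrightarrow> real (card A) \<le> b"
  shows "\<exists>A. finite A \<and> A \<subseteq> B \<and> separated n r A \<and>
    (\<forall>x\<in>B. \<exists>a\<in>A. (\<Sum>i<n. (x i - a i)^2) \<le> r^2 * real n)"
proof -
  let ?P = "\<lambda>A. finite A \<and> A \<subseteq> B \<and> separated n r A"
  have "?P {}" by (simp add: separated_def)
  moreover have "\<forall>A. ?P A \<longrightarrow> card A < Suc (nat \<lceil>b\<rceil>)"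
  proof (intro allI impI)
    fix A assume "?P A"
    hence "real (card A) \<le> b" using bound by blast
    thus "card A < Suc (nat \<lceil>b\<rceil>)" by linarith
  qed
  ultimately obtain A where A: "?P A" and max: "\<And>A'. ?P A' \<Longrightarrow> card A' \<le> card A"
    using ex_has_greatest_nat[of ?P "{}" card "Suc (nat \<lceil>b\<rceil>)"] by blast
  have "\<exists>a\<in>A. (\<Sum>i<n. (x i - a i)^2) \<le> r^2 * real n" if x: "x \<in> B" for x
  proof (rule ccontr)
    assume far: "\<not> ?thesis"
    hence "x \<notin> A" by force
    have "r^2 * real n \<le> (\<Sum>i<n. (x i - a i)^2)" if "a \<in> A" for a
      using far that by (auto simp: not_le intro: less_imp_le)
    moreover have "(\<Sum>i<n. (a i - x i)^2) = (\<Sum>i<n. (x i - a i)^2)" for a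
      by (intro sum.cong refl power2_commute)
    ultimately have "separated n r (insert x A)"
      using A unfolding separated_def by simp
    hence "card (insert x A) \<le> card A" using A x by (intro max) simp
    thus False using A \<open>x \<notin> A\<close> by simp
  qed
  thus ?thesis using A by blast
qed

lemma mem_translated_ball:
  fixes r :: real
  assumes x: "x \<in> coord_subspace {..<n}" and a: "a \<in> coord_subspace {..<n}"
    and r: "r > 0" and le: "(\<Sum>i<n. (x i - a i)^2) \<le> r^2"
  shows "x \<in> (+) a ` (*\<^sub>R) r ` unit_ball n"
proof -
  let ?y = "\<lambda>i. (x i - a i) / r"
  have "L2_set ?y {..<n} = sqrt ((\<Sum>i<n. (x i - a i)^2) / r^2)"
    by (simp add: L2_set_def power_divide sum_divide_distrib)
  also have "\<dots> \<le> 1" using le r by simp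
  finally have "?y \<in> unit_ball n" using x a by (simp add: unit_ball_def coord_subspace_def)
  moreover have "x = a + r *\<^sub>R ?y" using r by (simp add: fun_eq_iff plus_fun_def scaleR_fun_def)
  ultimately show ?thesis by blast
qed

theorem corollary2:
  shows "\<exists>K c :: real. K > 0 \<and> c > 0 \<and>
    (\<forall>(n::nat) (B :: (nat \<Rightarrow> real) set) (t::real).
       n \<ge> 1 \<longrightarrow> convex_body n B \<longrightarrow> B \<subseteq> cube {..<n} 1 \<longrightarrow> 0 < t \<longrightarrow> t < 1 \<longrightarrow>
         ereal_of_enat (covering_number n B ((*\<^sub>R) (t * sqrt (real n)) ` unit_ball n))
           \<le> ereal ((2 / t) powr (K * real (max_cube_dim n B (c * t)))))"
proof (rule exI[of _ 40], rule exI[of _ "1/16"], intro conjI allI impI)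
  fix n :: nat and B :: "(nat \<Rightarrow> real) set" and t :: real
  assume n: "n \<ge> 1" and body: "convex_body n B" and B: "B \<subseteq> cube {..<n} 1" and t: "0 < t" "t < 1"
  let ?d = "max_cube_dim n B (1 / 16 * t)"
  have conv: "convex B" using body by (simp add: convex_body_def)
  have bound: "real (card A) \<le> (2 / t) ^ (40 * ?d)"
    if A: "finite A" "A \<subseteq> B" "separated n t A" for A
  proof (rule card_separated_le[OF n t A(1) _ A(3)])
    show "0 \<le> x i \<and> x i \<le> 1" if "x \<in> A" "i < n" for x i
      using that A(2) B by (auto simp: cube_def)
  next
    fix s h assume s: "s \<subseteq> {..<n}"
      and orth: "\<And>u. u \<subseteq> s \<Longrightarrow> \<exists>x\<in>A. (\<forall>i\<in>u. x i \<le> h i) \<and> (\<forall>i\<in>s - u. h i + t / 16 \<le> x i)"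
    show "card s \<le> ?d"
    proof (rule card_le_max_cube_dim[OF s conv])
      fix u assume "u \<subseteq> s"
      from orth[OF this] A(2)
      show "\<exists>x\<in>B. (\<forall>i\<in>u. x i \<le> h i) \<and> (\<forall>i\<in>s - u. h i + 1 / 16 * t \<le> x i)" by auto
    qed
  qed
  have "\<exists>A. finite A \<and> A \<subseteq> B \<and> separated n t A \<and>
      (\<forall>x\<in>B. \<exists>a\<in>A. (\<Sum>i<n. (x i - a i)^2) \<le> t^2 * real n)"
    by (rule exists_separated_net) (rule bound)
  then obtain A where A: "finite A" "A \<subseteq> B" "separated n t A"
    and net: "\<forall>x\<in>B. \<exists>a\<in>A. (\<Sum>i<n. (x i - a i)^2) \<le> t^2 * real n"
    by blast
  let ?D = "(*\<^sub>R) (t * sqrt (real n)) ` unit_ball n"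
  have sub: "B \<subseteq> coord_subspace {..<n}" using B by (auto simp: cube_def)
  have "B \<subseteq> (\<Union>a\<in>A. (+) a ` ?D)"
  proof
    fix x assume x: "x \<in> B"
    obtain a where "a \<in> A" "(\<Sum>i<n. (x i - a i)^2) \<le> t^2 * real n"
      using net x by blast
    hence a: "a \<in> A" "(\<Sum>i<n. (x i - a i)^2) \<le> (t * sqrt n)^2"
      by (simp_all add: power_mult_distrib)
    have "x \<in> (+) a ` ?D"
      using x a A(2) sub n t by (intro mem_translated_ball) auto
    thus "x \<in> (\<Union>a\<in>A. (+) a ` ?D)" using a(1) by blast
  qed
  hence "covering_number n B ?D \<le> enat (card A)"
    unfolding covering_number_def using A sub by (intro INF_lower) auto
  hence "ereal_of_enat (covering_number n B ?D) \<le> ereal_of_enat (enat (card A))"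
    by (simp only: ereal_of_enat_le_iff)
  also have "\<dots> \<le> ereal ((2 / t) ^ (40 * ?d))" using bound[OF A] by simp
  also have "(2 / t) ^ (40 * ?d) = (2 / t) powr (40 * real ?d)"
    using t powr_realpow[of "2 / t" "40 * ?d"] by simp
  finally show "ereal_of_enat (covering_number n B ?D) \<le> ereal ((2 / t) powr (40 * real ?d))" .
qed simp_all

end
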